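(* Let $1\le k<d$ be integers and let $\{(V_j,\omega_j)\}_{j=1}^n$ be a cubature of strength $4$ for $\mathcal{G}_{k,d}$. If $x\in S^{d-1}$, then $$P_x=a_1\sum_{j=1}^n \omega_j \|P_{V_j}(x)\|^2 P_{V_j} - a_2 I,$$ where $a_1=\frac{d(d+2)(d-1)}{2k(d-k)}$ and $a_2=\frac{kd+k-2}{2(d-k)}$.
   Context: $\mathcal{G}_{k,d}$ is the real Grassmann space of $k$-dimensional linear subspaces of $\mathbb{R}^d$, and $\sigma_k$ is the probability measure on $\mathcal{G}_{k,d}$ induced by the Haar measure on the real orthogonal group $O(\mathbb{R}^d)$. For a subspace $V$, $P_V$ is the orthogonal projector onto $V$; for $x\in S^{d-1}$ (the unit sphere of $\mathbb{R}^d$), $P_x$ is the orthogonal projector onto the line $\mathbb{R}x$, i.e. $P_x=xx^*$. $\|\cdot\|$ is the Euclidean norm, $I$ is the $d\times d$ identity matrix, and $\langle A,B\rangle=\operatorname{trace}(AB)$ for symmetric matrices. The space of polynomial functions on $\mathcal{G}_{k,d}$ of degree at most $2p$ is $$\operatorname{Pol}_{\leq 2p}(\mathcal{G}_{k,d})=\operatorname{span}\{V\mapsto \langle P_{x_1},P_V\rangle\cdots\langle P_{x_p},P_V\rangle : x_1,\dots,x_p\in S^{d-1}\}.$$ Given $V_1,\dots,V_n\in\mathcal{G}_{k,d}$ and positive weights $\omega_1,\dots,\omega_n$ with $\sum_{j=1}^n\omega_j=1$, the collection $\{(V_j,\omega_j)\}_{j=1}^n$ is called a cubature of strength $2p$ for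 $\mathcal{G}_{k,d}$ if $\int_{\mathcal{G}_{k,d}} f(V)\,d\sigma_k(V)=\sum_{j=1}^n\omega_j f(V_j)$ for all $f\in\operatorname{Pol}_{\leq 2p}(\mathcal{G}_{k,d})$. (Strength $4$ is the case $p=2$.) *)

theory Defs
  imports "HOL-Analysis.Analysis" "HOL-Probability.Probability"
begin

definition grassmannian :: "nat \<Rightarrow> (real ^ 'd) set set" where
  "grassmannian k = {V. subspace V \<and> dim V = k}"

definition projector :: "(real ^ 'd) set \<Rightarrow> real ^ 'd ^ 'd" where
  "projector V = matrix (\<lambda>x. THE y. y \<in> V \<and> (\<forall>v\<in>V. orthogonal (x - y) v))"

abbreviation line_projector :: "real ^ 'd \<Rightarrow> real ^ 'd ^ 'd" where
  "line_projector x \<equiv> projector (span {x})"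

definition trace_inner :: "real ^ 'd ^ 'd \<Rightarrow> real ^ 'd ^ 'd \<Rightarrow> real" where
  "trace_inner A B = trace (A ** B)"

definition orthogonal_group :: "(real ^ 'd ^ 'd) set" where
  "orthogonal_group = {Q. orthogonal_matrix Q}"

text \<open>
  The normalised Haar measure on the orthogonal group is the unique measure satisfying this
  predicate; notions depending on it take it as a parameter.
\<close>

definition haar_probability :: "(real ^ 'd ^ 'd) measure \<Rightarrow> bool" where
  "haar_probability H \<longleftrightarrow>
     prob_space H \<and>
     sets H = sets (restrict_space borel orthogonal_group) \<and>
     (\<forall>Q\<in>orthogonal_group. distr H H (\<lambda>R. Q ** R) = H)"

text \<open>
  The Grassmannian carries the topology for which \<open>projector\<close> is an embedding into the matrices;
  this is its Borel \<open>\<sigma>\<close>-algebra.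
\<close>

definition grassmannian_borel :: "nat \<Rightarrow> (real ^ 'd) set measure" where
  "grassmannian_borel k = vimage_algebra (grassmannian k) projector borel"

text \<open>
  The image of Haar measure under the orbit map of a base point. The result does not depend on
  the base point, since the action is transitive and Haar measure on a compact group is also
  right invariant.
\<close>

definition grassmannian_measure ::
    "(real ^ 'd ^ 'd) measure \<Rightarrow> nat \<Rightarrow> (real ^ 'd) set measure" where
  "grassmannian_measure H k =
     distr H (grassmannian_borel k) (\<lambda>Q. (*v) Q ` (SOME V. V \<in> grassmannian k))"

text \<open>
  The space of polynomial functions of degree at most \<open>2 * p\<close>, with the span written out as finite
  linear combinations. Its members are functions on \<open>grassmannian k\<close>; values elsewhere are
  unconstrained.
\<close>

definition grassmannian_Pol :: "nat \<Rightarrow> nat \<Rightarrow> ((real ^ 'd) set \<Rightarrow> real) set" where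
  "grassmannian_Pol k p =
     {f. \<exists>(m::nat) (c :: nat \<Rightarrow> real) (X :: nat \<Rightarrow> nat \<Rightarrow> real ^ 'd).
           (\<forall>i<m. \<forall>l<p. X i l \<in> sphere 0 1) \<and>
           (\<forall>V\<in>grassmannian k.
              f V = (\<Sum>i<m. c i * (\<Prod>l<p. trace_inner (line_projector (X i l)) (projector V))))}"

text \<open>A cubature of strength \<open>2 * p\<close>, with nodes and weights indexed by \<open>{1..n}\<close>.\<close>

definition grassmannian_cubature ::
    "(real ^ 'd ^ 'd) measure \<Rightarrow> nat \<Rightarrow> nat \<Rightarrow> nat \<Rightarrow> (nat \<Rightarrow> (real ^ 'd) set) \<Rightarrow> (nat \<Rightarrow> real) \<Rightarrow> bool"
  where
  "grassmannian_cubature H k p n V \<omega> \<longleftrightarrow>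
     (\<forall>j\<in>{1..n}. V j \<in> grassmannian k) \<and>
     (\<forall>j\<in>{1..n}. 0 < \<omega> j) \<and>
     (\<Sum>j=1..n. \<omega> j) = 1 \<and>
     (\<forall>f\<in>grassmannian_Pol k p.
        (LINT W|grassmannian_measure H k. f W) = (\<Sum>j=1..n. \<omega> j * f (V j)))"

end

theory Submission
  imports Defs
begin

text \<open>
  Write \<open>P\<^sub>j\<close> for the projector onto \<open>V j\<close>. Cubature of strength 4 turns left invariance of Haar
  measure into invariance of \<open>e u v = (\<Sum>j. \<omega> j * (u \<bullet> P\<^sub>j u) * (v \<bullet> P\<^sub>j v))\<close> under simultaneous
  orthogonal transformations of \<open>u\<close> and \<open>v\<close>. Hence, with respect to an orthonormal basis containing
  \<open>x\<close>, reflections show that the operator \<open>\<Sum>j. \<omega> j * (x \<bullet> P\<^sub>j x) * P\<^sub>j\<close> is diagonal, with one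
  eigenvalue \<open>e x x\<close> at \<open>x\<close> and another one, \<open>e x b\<close>, on its complement. These two numbers are
  determined by the trace condition and by \<open>P\<^sub>j\<^sup>2 = P\<^sub>j\<close>, which uses the average of \<open>(x \<bullet> P\<^sub>j b)\<^sup>2\<close>,
  obtained by polarising \<open>e\<close> at \<open>x \<plusminus> b\<close>.
\<close>

subsection \<open>Reflections and orthonormal bases\<close>

text \<open>Since \<open>a / 0 = 0\<close>, the map \<open>reflect 0\<close> is the identity and needs no exclusion.\<close>

definition reflect :: "'a::real_inner \<Rightarrow> 'a \<Rightarrow> 'a" where
  "reflect v x = x - (2 * (v \<bullet> x) / (v \<bullet> v)) *\<^sub>R v"

lemma orthogonal_transformation_reflect: "orthogonal_transformation (reflect v)"
proof (cases "v = 0")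
  case True
  then show ?thesis
    by (simp add: orthogonal_transformation_def linear_iff reflect_def)
next
  case False
  have "linear (reflect v)"
    by (rule linearI) (simp_all add: reflect_def inner_add_right algebra_simps add_divide_distrib)
  moreover have "reflect v x \<bullet> reflect v y = x \<bullet> y" for x y
    using False
    by (simp add: reflect_def inner_diff_left inner_diff_right inner_commute field_simps)
  ultimately show ?thesis
    by (simp add: orthogonal_transformation_def)
qed

lemma reflect_orthogonal: "v \<bullet> x = 0 \<Longrightarrow> reflect v x = x"
  by (simp add: reflect_def)

lemma reflect_minus: "reflect (- v) x = reflect v x"
  by (simp add: reflect_def)

lemma reflect_self: "reflect v v = - v"
  by (cases "v = 0") (simp_all add: reflect_def scaleR_2)

text \<open>Equal norms give \<open>(u - w) \<bullet> (u - w) = 2 * ((u - w) \<bullet> u)\<close>,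
  so the coefficient in \<open>reflect\<close> is 1. Thus one reflection joins any two vectors of
  equal length.\<close>

lemma reflect_swap:
  assumes "norm u = norm w"
  shows "reflect (u - w) u = w"
proof (cases "u = w")
  case False
  have eq: "u \<bullet> u = w \<bullet> w"
    using assms by (simp add: norm_eq)
  have "(u - w) \<bullet> (u - w) = 2 * ((u - w) \<bullet> u)"
    using eq by (simp add: inner_diff_left inner_diff_right inner_commute)
  moreover have "(u - w) \<bullet> (u - w) \<noteq> 0"
    using False by simp
  ultimately have "2 * ((u - w) \<bullet> u) / ((u - w) \<bullet> (u - w)) = 1"
    by (metis divide_self)
  then have "reflect (u - w) u = u - 1 *\<^sub>R (u - w)"
    by (simp only: reflect_def)
  then show ?thesis
    by simp
qed (simp add: reflect_def)

definition orthonormal_basis :: "'a::euclidean_space set \<Rightarrow> bool" where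
  "orthonormal_basis B \<longleftrightarrow>
     finite B \<and> card B = DIM('a) \<and> span B = UNIV \<and> (\<forall>u\<in>B. \<forall>w\<in>B. u \<bullet> w = (if u = w then 1 else 0))"

lemma orthonormal_basis_containing:
  fixes x :: "'a::euclidean_space"
  assumes "norm x = 1"
  obtains B where "orthonormal_basis B" "x \<in> B"
proof -
  obtain B where B: "x \<in> B" "pairwise orthogonal B" "\<And>b. b \<in> B \<Longrightarrow> norm b = 1"
    "independent B" "card B = DIM('a)" "span B = UNIV"
    using vector_in_orthonormal_basis[OF assms] by metis
  have "u \<bullet> w = (if u = w then 1 else 0)" if "u \<in> B" "w \<in> B" for u w
    using B(2,3) that by (auto simp: pairwise_def orthogonal_def dot_square_norm)
  then show ?thesis
    using that[of B] B finiteI_independent[OF B(4)] by (auto simp: orthonormal_basis_def)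
qed

lemma orthonormal_expansion:
  fixes y :: "'a::euclidean_space"
  assumes fin: "finite C" and on: "\<And>u w. u \<in> C \<Longrightarrow> w \<in> C \<Longrightarrow> u \<bullet> w = (if u = w then 1 else 0)"
    and y: "y \<in> span C"
  shows "(\<Sum>c\<in>C. (y \<bullet> c) *\<^sub>R c) = y"
proof -
  obtain a where a: "y = (\<Sum>c\<in>C. a c *\<^sub>R c)"
    using y by (auto simp: span_finite[OF fin])
  have "y \<bullet> c = a c" if "c \<in> C" for c
  proof -
    have "y \<bullet> c = (\<Sum>b\<in>C. a b * (b \<bullet> c))"
      by (simp add: a inner_sum_left)
    also have "\<dots> = (\<Sum>b\<in>C. if b = c then a b else 0)"
      using that by (intro sum.cong) (auto simp: on)
    finally show ?thesis
      using that fin by simp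
  qed
  then show ?thesis
    using a by (metis (mono_tags, lifting) sum.cong)
qed

text \<open>Basis independence of the trace: expand each \<open>b\<close> in \<open>Basis\<close>,
  swap the sums and resum over \<open>B\<close>. This moves a trace condition to a basis adapted to
  \<open>x\<close>.\<close>

lemma trace_orthonormal_basis:
  fixes f :: "'a::euclidean_space \<Rightarrow> 'a"
  assumes B: "orthonormal_basis B" and f: "linear f"
  shows "(\<Sum>b\<in>B. b \<bullet> f b) = (\<Sum>c\<in>Basis. c \<bullet> f c)"
proof -
  have "b \<bullet> f b = (\<Sum>c\<in>Basis. (b \<bullet> c) * (b \<bullet> f c))" for b
  proof -
    have "f b = f (\<Sum>c\<in>Basis. (b \<bullet> c) *\<^sub>R c)"
      by (simp add: euclidean_representation)
    also have "\<dots> = (\<Sum>c\<in>Basis. (b \<bullet> c) *\<^sub>R f c)"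
      by (simp add: linear_sum[OF f] linear_cmul[OF f])
    finally show ?thesis
      by (simp add: inner_sum_right)
  qed
  then have "(\<Sum>b\<in>B. b \<bullet> f b) = (\<Sum>b\<in>B. \<Sum>c\<in>Basis. (b \<bullet> c) * (b \<bullet> f c))"
    by simp
  also have "\<dots> = (\<Sum>c\<in>Basis. \<Sum>b\<in>B. (b \<bullet> c) * (b \<bullet> f c))"
    by (rule sum.swap)
  also have "\<dots> = (\<Sum>c\<in>Basis. (\<Sum>b\<in>B. (c \<bullet> b) *\<^sub>R b) \<bullet> f c)"
    unfolding inner_sum_left inner_scaleR_left by (intro sum.cong) (simp_all add: inner_commute)
  also have "\<dots> = (\<Sum>c\<in>Basis. c \<bullet> f c)"
    using B by (simp add: orthonormal_basis_def orthonormal_expansion)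
  finally show ?thesis .
qed

subsection \<open>Invariant families of projections\<close>

text \<open>The linear-algebra core, free of measures: the \<open>p j\<close> are orthogonal
  projections of trace \<open>\<kappa>\<close>, and cubature enters only through the invariance of
  \<open>e\<close>. The constants come from two linear equations for \<open>e x x\<close> and
  \<open>e x b\<close>: \<open>\<alpha>\<close> is the value of \<open>e x b\<close>, and
  \<open>\<beta>\<close> is the difference \<open>e x x - e x b\<close>.\<close>

lemma invariant_projections_moment:
  fixes p :: "'i \<Rightarrow> 'a::euclidean_space \<Rightarrow> 'a" and w :: "'i \<Rightarrow> real" and J :: "'i set" and \<kappa> :: real
  defines "e \<equiv> \<lambda>u v. \<Sum>j\<in>J. w j * ((u \<bullet> p j u) * (v \<bullet> p j v))"
  assumes dim: "2 \<le> DIM('a)" and \<kappa>: "\<kappa> \<noteq> 0"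
    and w: "(\<Sum>j\<in>J. w j) = 1"
    and lin: "\<And>j. j \<in> J \<Longrightarrow> linear (p j)"
    and sym: "\<And>j u v. j \<in> J \<Longrightarrow> u \<bullet> p j v = v \<bullet> p j u"
    and idem: "\<And>j u. j \<in> J \<Longrightarrow> p j (p j u) = p j u"
    and tr: "\<And>j. j \<in> J \<Longrightarrow> (\<Sum>b\<in>Basis. b \<bullet> p j b) = \<kappa>"
    and inv: "\<And>f u v. orthogonal_transformation f \<Longrightarrow> e (f u) (f v) = e u v"
    and x: "norm x = 1"
    and d: "d = real DIM('a)"
    and \<beta>: "\<beta> = 2 * \<kappa> * (d - \<kappa>) / (d * (d + 2) * (d - 1))"
    and \<alpha>: "\<alpha> = \<kappa> / d - (d + 1) * \<beta> / 2"
  shows "(\<Sum>j\<in>J. (w j * (x \<bullet> p j x)) *\<^sub>R p j y) = \<alpha> *\<^sub>R y + (\<beta> * (x \<bullet> y)) *\<^sub>R x"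
proof -
  obtain B where B: "orthonormal_basis B" and xB: "x \<in> B"
    using orthonormal_basis_containing[OF x] .
  have finB: "finite B" and cardB: "real (card B) = d" and spanB: "span B = UNIV"
    and on: "\<And>u v. u \<in> B \<Longrightarrow> v \<in> B \<Longrightarrow> u \<bullet> v = (if u = v then 1 else 0)"
    using B by (auto simp: orthonormal_basis_def d)
  have expand: "(\<Sum>c\<in>B. (v \<bullet> c) *\<^sub>R c) = v" for v
    by (rule orthonormal_expansion) (auto simp: finB on spanB)
  have nB: "norm b = 1" if "b \<in> B" for b
    using on[OF that that] by (simp add: norm_eq_1)
  \<comment> \<open>The reflection along \<open>b - c\<close> acts on \<open>B\<close> as the
    transposition of \<open>b\<close> and \<open>c\<close>, so \<open>e\<close> can be compared on
    different pairs of basis vectors.\<close>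
  have refl_fix: "reflect (b - c) u = u" if "b \<in> B" "c \<in> B" "u \<in> B" "u \<noteq> b" "u \<noteq> c" for b c u
    using that by (intro reflect_orthogonal) (simp add: inner_diff_left on)
  have refl_swap: "reflect (b - c) b = c" "reflect (b - c) c = b" if "b \<in> B" "c \<in> B" for b c
  proof -
    show "reflect (b - c) b = c"
      using that by (intro reflect_swap) (simp add: nB)
    have "reflect (c - b) c = b"
      using that by (intro reflect_swap) (simp add: nB)
    then show "reflect (b - c) c = b"
      using reflect_minus[of "c - b" c] by simp
  qed
  have ref_inv: "e (reflect v a) (reflect v b) = e a b" for v a b
    by (rule inv[OF orthogonal_transformation_reflect])
  obtain b0 where b0: "b0 \<in> B" "b0 \<noteq> x"
  proof -
    have "card B \<ge> 2"
      using dim B by (simp add: orthonormal_basis_def)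
    then have "\<not> B \<subseteq> {x}"
      by (metis One_nat_def Suc_1 card.empty card.insert card_mono empty_iff finite.emptyI finite_insert not_less_eq_eq)
    then show ?thesis
      using that by auto
  qed
  \<comment> \<open>The two unknowns; they turn out to be \<open>\<alpha> + \<beta>\<close> and
    \<open>\<alpha>\<close>.\<close>
  define \<gamma>' where "\<gamma>' = e x x"
  define \<alpha>' where "\<alpha>' = e x b0"
  have \<gamma>': "e b b = \<gamma>'" if "b \<in> B" for b
    using ref_inv[of "x - b" x x] refl_swap[OF xB that] by (simp add: \<gamma>'_def)
  have \<alpha>': "e x b = \<alpha>'" if "b \<in> B" "b \<noteq> x" for b
    using ref_inv[of "b0 - b" x b0] refl_swap[OF b0(1) that(1)] refl_fix[OF b0(1) that(1) xB] b0 that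
    by (auto simp: \<alpha>'_def)
  have sumB: "(\<Sum>b\<in>B. if b = x then r else s) = r + (d - 1) * s" for r s :: real
  proof -
    have "(\<Sum>b\<in>B. if b = x then r else s) = r + (\<Sum>b\<in>B - {x}. s)"
      using xB finB by (subst sum.remove[of _ x]) (auto intro!: sum.cong)
    moreover have "real (card (B - {x})) = d - 1"
      using xB finB cardB dim d by (simp add: card_Diff_singleton of_nat_diff)
    ultimately show ?thesis
      by simp
  qed

  \<comment> \<open>The weighted mean of the quadratic forms. Summing \<open>e u c\<close> over
    \<open>c\<close> recovers it up to the factor \<open>\<kappa>\<close>, by the trace
    condition.\<close>
  define \<mu> where "\<mu> u = (\<Sum>j\<in>J. w j * (u \<bullet> p j u))" for u
  have trB: "(\<Sum>b\<in>B. b \<bullet> p j b) = \<kappa>" if "j \<in> J" for j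
    using trace_orthonormal_basis[OF B lin[OF that]] tr[OF that] by simp
  have sum_e: "(\<Sum>c\<in>B. e u c) = \<kappa> * \<mu> u" for u
  proof -
    have "(\<Sum>c\<in>B. e u c) = (\<Sum>j\<in>J. \<Sum>c\<in>B. w j * ((u \<bullet> p j u) * (c \<bullet> p j c)))"
      unfolding e_def by (rule sum.swap)
    also have "\<dots> = (\<Sum>j\<in>J. w j * ((u \<bullet> p j u) * (\<Sum>c\<in>B. c \<bullet> p j c)))"
      by (simp add: sum_distrib_left)
    also have "\<dots> = (\<Sum>j\<in>J. \<kappa> * (w j * (u \<bullet> p j u)))"
      by (intro sum.cong) (auto simp: trB)
    finally show ?thesis
      by (simp add: \<mu>_def sum_distrib_left)
  qed
  \<comment> \<open>Invariance is assumed for \<open>e\<close> only; it passes to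
    \<open>\<mu>\<close> because the transposition of \<open>b\<close> and \<open>x\<close> permutes
    \<open>B\<close> and \<open>\<kappa>\<close> is nonzero.\<close>
  have \<mu>x: "\<mu> b = \<mu> x" if "b \<in> B" for b
  proof -
    let ?f = "reflect (b - x)"
    have inv_f: "?f (?f c) = c \<and> ?f c \<in> B" if "c \<in> B" for c
      using refl_swap[OF \<open>b \<in> B\<close> xB] refl_fix[OF \<open>b \<in> B\<close> xB \<open>c \<in> B\<close>] that xB \<open>b \<in> B\<close>
      by (cases "c = b"; cases "c = x") auto
    have "(\<Sum>c\<in>B. e b c) = (\<Sum>c\<in>B. e x c)"
    proof (rule sum.reindex_bij_witness[of _ ?f ?f])
      fix c assume "c \<in> B"
      show "e x (?f c) = e b c"
        using ref_inv[of "b - x" b c] refl_swap[OF that xB] by simp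
    qed (use inv_f in auto)
    then show ?thesis
      using \<kappa> by (simp add: sum_e)
  qed
  have "d * \<mu> x = (\<Sum>b\<in>B. \<mu> b)"
    by (simp add: \<mu>x cardB)
  also have "\<dots> = (\<Sum>j\<in>J. \<Sum>b\<in>B. w j * (b \<bullet> p j b))"
    unfolding \<mu>_def by (rule sum.swap)
  also have "\<dots> = (\<Sum>j\<in>J. w j * (\<Sum>b\<in>B. b \<bullet> p j b))"
    by (simp add: sum_distrib_left)
  also have "\<dots> = (\<Sum>j\<in>J. w j * \<kappa>)"
    by (intro sum.cong) (auto simp: trB)
  also have "\<dots> = \<kappa>"
    by (simp add: sum_distrib_right[symmetric] w)
  finally have d\<mu>: "d * \<mu> x = \<kappa>" .

  \<comment> \<open>First equation for the unknowns, from the trace.\<close>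
  have "\<kappa> * \<mu> x = (\<Sum>c\<in>B. e x c)"
    by (simp add: sum_e)
  also have "\<dots> = (\<Sum>c\<in>B. if c = x then \<gamma>' else \<alpha>')"
    by (intro sum.cong) (auto simp: \<gamma>' \<alpha>')
  finally have eq1: "\<kappa> * \<mu> x = \<gamma>' + (d - 1) * \<alpha>'"
    by (simp add: sumB)

  \<comment> \<open>Polarisation: \<open>x + b\<close> and \<open>x - b\<close> have squared norm 2,
    so each is carried by a reflection to \<open>sqrt 2 *\<^sub>R x\<close>, and homogeneity of
    degree 4 gives \<open>4 * \<gamma>'\<close>. In the sum of both expansions the terms odd in
    \<open>b\<close> cancel.\<close>
  have mixed: "(\<Sum>j\<in>J. w j * (x \<bullet> p j b)\<^sup>2) = (\<gamma>' - \<alpha>') / 2" if b: "b \<in> B" "b \<noteq> x" for b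
  proof -
    have e4: "e u u = 4 * \<gamma>'" if "u \<bullet> u = 2" for u
    proof -
      have uu: "norm u = norm (sqrt 2 *\<^sub>R x)"
        using that x by (simp add: norm_eq_sqrt_inner)
      have "e u u = e (sqrt 2 *\<^sub>R x) (sqrt 2 *\<^sub>R x)"
        using ref_inv[of "u - sqrt 2 *\<^sub>R x" u u] reflect_swap[OF uu] by simp
      also have "\<dots> = (\<Sum>j\<in>J. 4 * (w j * ((x \<bullet> p j x) * (x \<bullet> p j x))))"
        unfolding e_def by (intro sum.cong) (auto simp: linear_cmul[OF lin])
      finally show ?thesis
        by (simp add: \<gamma>'_def e_def sum_distrib_left)
    qed
    have p1: "(x + b) \<bullet> (x + b) = 2" and p2: "(x - b) \<bullet> (x - b) = 2"
      using b xB by (auto simp: inner_add_left inner_add_right inner_diff_left inner_diff_right on)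
    have "8 * \<gamma>' = e (x + b) (x + b) + e (x - b) (x - b)"
      using e4[OF p1] e4[OF p2] by simp
    also have "\<dots> = (\<Sum>j\<in>J. 2 * (w j * ((x \<bullet> p j x) * (x \<bullet> p j x))) + 2 * (w j * ((b \<bullet> p j b) * (b \<bullet> p j b)))
        + 4 * (w j * ((x \<bullet> p j x) * (b \<bullet> p j b))) + 8 * (w j * (x \<bullet> p j b)\<^sup>2))"
      unfolding e_def sum.distrib[symmetric]
    proof (intro sum.cong refl)
      fix j assume j: "j \<in> J"
      have "b \<bullet> p j x = x \<bullet> p j b"
        by (rule sym[OF j])
      then show "w j * ((x + b) \<bullet> p j (x + b) * ((x + b) \<bullet> p j (x + b)))
          + w j * ((x - b) \<bullet> p j (x - b) * ((x - b) \<bullet> p j (x - b)))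
        = 2 * (w j * ((x \<bullet> p j x) * (x \<bullet> p j x))) + 2 * (w j * ((b \<bullet> p j b) * (b \<bullet> p j b)))
        + 4 * (w j * ((x \<bullet> p j x) * (b \<bullet> p j b))) + 8 * (w j * (x \<bullet> p j b)\<^sup>2)"
        by (simp add: linear_add[OF lin[OF j]] linear_diff[OF lin[OF j]] inner_add_left inner_add_right
            inner_diff_left inner_diff_right) (simp add: algebra_simps power2_eq_square)
    qed
    also have "\<dots> = 2 * e x x + 2 * e b b + 4 * e x b + 8 * (\<Sum>j\<in>J. w j * (x \<bullet> p j b)\<^sup>2)"
      by (simp add: e_def sum.distrib sum_distrib_left)
    also have "\<dots> = 4 * \<gamma>' + 4 * \<alpha>' + 8 * (\<Sum>j\<in>J. w j * (x \<bullet> p j b)\<^sup>2)"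
      using b xB by (simp add: \<gamma>' \<alpha>')
    finally show ?thesis
      by simp
  qed
  \<comment> \<open>Second equation, from idempotence: \<open>x \<bullet> p j x\<close> is the
    squared norm of \<open>p j x\<close>, expanded over \<open>B\<close>.\<close>
  have "\<mu> x = (\<Sum>j\<in>J. \<Sum>b\<in>B. w j * (x \<bullet> p j b)\<^sup>2)"
    unfolding \<mu>_def
  proof (intro sum.cong refl)
    fix j assume j: "j \<in> J"
    have "x \<bullet> p j x = p j x \<bullet> p j x"
      by (metis idem[OF j] sym[OF j] )
    also have "\<dots> = (\<Sum>b\<in>B. (p j x \<bullet> b) *\<^sub>R b) \<bullet> p j x"
      by (simp add: expand)
    also have "\<dots> = (\<Sum>b\<in>B. (x \<bullet> p j b)\<^sup>2)"
      unfolding inner_sum_left inner_scaleR_left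
      by (intro sum.cong) (simp_all add: power2_eq_square sym[OF j, of x] inner_commute[of _ "p j x"])
    finally show "w j * (x \<bullet> p j x) = (\<Sum>b\<in>B. w j * (x \<bullet> p j b)\<^sup>2)"
      by (simp add: sum_distrib_left)
  qed
  also have "\<dots> = (\<Sum>b\<in>B. \<Sum>j\<in>J. w j * (x \<bullet> p j b)\<^sup>2)"
    by (rule sum.swap)
  also have "\<dots> = (\<Sum>b\<in>B. if b = x then \<gamma>' else (\<gamma>' - \<alpha>') / 2)"
  proof (intro sum.cong refl)
    fix b assume "b \<in> B"
    then show "(\<Sum>j\<in>J. w j * (x \<bullet> p j b)\<^sup>2) = (if b = x then \<gamma>' else (\<gamma>' - \<alpha>') / 2)"
      by (cases "b = x") (simp_all add: mixed, simp add: \<gamma>'_def e_def power2_eq_square)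
  qed
  finally have eq2: "\<mu> x = \<gamma>' + (d - 1) * ((\<gamma>' - \<alpha>') / 2)"
    by (simp add: sumB)

  have d2: "d \<ge> 2"
    using dim d by simp
  \<comment> \<open>Both equations are multiplied by \<open>d\<close> to replace
    \<open>d * \<mu> x\<close> by \<open>\<kappa>\<close>; eliminating \<open>\<gamma>'\<close> then
    leaves one equation for the difference.\<close>
  have diff: "\<gamma>' - \<alpha>' = \<beta>"
  proof -
    have "d * (\<gamma>' + (d - 1) * ((\<gamma>' - \<alpha>') / 2)) - d * (\<gamma>' + (d - 1) * \<alpha>') = \<kappa> - \<kappa> * \<kappa>"
      using eq1 eq2 d\<mu> by (metis mult.left_commute)
    moreover have "d * (\<gamma>' + (d - 1) * \<alpha>') = \<kappa> * \<kappa>"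
      using eq1 d\<mu> by (metis mult.left_commute)
    moreover have "d * (\<gamma>' + (d - 1) * ((\<gamma>' - \<alpha>') / 2)) = \<kappa>"
      using eq2 d\<mu> by simp
    ultimately have "(\<gamma>' - \<alpha>') * (d * (d + 2) * (d - 1)) = 2 * \<kappa> * (d - \<kappa>)"
      by algebra
    moreover have "d * (d + 2) * (d - 1) \<noteq> 0"
      using d2 by simp
    ultimately show ?thesis
      unfolding \<beta> by (metis nonzero_eq_divide_eq)
  qed
  have \<alpha>'\<alpha>: "\<alpha>' = \<alpha>"
  proof -
    have "\<mu> x = \<kappa> / d"
      using d\<mu> d2 by (simp add: field_simps)
    then show ?thesis
      using eq2 diff unfolding \<alpha> by (simp add: field_simps)
  qed
  then have \<gamma>'\<beta>: "\<gamma>' = \<alpha> + \<beta>"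
    using diff by simp

  \<comment> \<open>Reflection along \<open>c\<close> fixes \<open>x\<close> and \<open>b\<close>
    and negates \<open>c\<close>, so \<open>e x (b + c) = e x (b - c)\<close>; their difference is
    four times the off-diagonal entry. Fixing \<open>x\<close> requires
    \<open>c \<noteq> x\<close>.\<close>
  have off: "(\<Sum>j\<in>J. w j * (x \<bullet> p j x) * (b \<bullet> p j c)) = 0" if bc: "b \<in> B" "c \<in> B" "b \<noteq> c" "c \<noteq> x" for b c
  proof -
    have rb: "reflect c x = x" "reflect c (b + c) = b - c"
      using bc xB
      by (auto simp: on reflect_orthogonal reflect_self
          linear_add[OF orthogonal_transformation_linear[OF orthogonal_transformation_reflect]])
    have "e x (b - c) = e x (b + c)"
      using ref_inv[of c x "b + c"] rb by simp
    moreover have "e x (b + c) - e x (b - c) = (\<Sum>j\<in>J. 4 * (w j * (x \<bullet> p j x) * (b \<bullet> p j c)))"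
      unfolding e_def sum_subtractf[symmetric]
    proof (intro sum.cong refl)
      fix j assume j: "j \<in> J"
      have "c \<bullet> p j b = b \<bullet> p j c"
        by (rule sym[OF j])
      then show "w j * (x \<bullet> p j x * ((b + c) \<bullet> p j (b + c))) - w j * (x \<bullet> p j x * ((b - c) \<bullet> p j (b - c)))
          = 4 * (w j * (x \<bullet> p j x) * (b \<bullet> p j c))"
        by (simp add: linear_add[OF lin[OF j]] linear_diff[OF lin[OF j]] inner_add_left inner_add_right
            inner_diff_left inner_diff_right) (simp add: algebra_simps)
    qed
    ultimately show ?thesis
      by (simp add: sum_distrib_left[symmetric])
  qed
  define L where "L y = (\<Sum>j\<in>J. (w j * (x \<bullet> p j x)) *\<^sub>R p j y)" for y
  have bL: "b \<bullet> L c = (\<Sum>j\<in>J. w j * (x \<bullet> p j x) * (b \<bullet> p j c))" for b c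
    by (simp add: L_def inner_sum_right)
  have Lsym: "b \<bullet> L c = c \<bullet> L b" for b c
    unfolding bL by (intro sum.cong) (auto simp: sym)
  \<comment> \<open>In the excluded case \<open>c = x\<close>, symmetry of \<open>L\<close>
    exchanges the roles of \<open>b\<close> and \<open>c\<close>.\<close>
  have L_off: "b \<bullet> L c = 0" if "b \<in> B" "c \<in> B" "b \<noteq> c" for b c
    using off[of b c] off[of c b] that Lsym[of b c] by (cases "c = x") (auto simp: bL)
  have L_diag: "c \<bullet> L c = \<alpha> + (if c = x then \<beta> else 0)" if "c \<in> B" for c
  proof -
    have "c \<bullet> L c = e x c"
      by (simp add: bL e_def mult.assoc)
    then show ?thesis
      using that \<alpha>'[of c] \<gamma>'_def \<gamma>'\<beta> \<alpha>'\<alpha> by auto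
  qed
  have "L y = (\<lambda>y. \<alpha> *\<^sub>R y + (\<beta> * (x \<bullet> y)) *\<^sub>R x) y"
  proof (rule linear_eq_on[of L _ y B])
    show "linear L"
      unfolding L_def by (intro linear_compose_sum ballI linear_compose_scale_right lin)
    show "linear (\<lambda>y. \<alpha> *\<^sub>R y + (\<beta> * (x \<bullet> y)) *\<^sub>R x)"
      by (rule linearI) (simp_all add: inner_add_right algebra_simps)
    show "y \<in> span B"
      by (simp add: spanB)
    fix c assume c: "c \<in> B"
    have "L c = (\<Sum>b\<in>B. (L c \<bullet> b) *\<^sub>R b)"
      by (simp add: expand)
    also have "\<dots> = (\<Sum>b\<in>B. if b = c then (c \<bullet> L c) *\<^sub>R c else 0)"
      using c by (intro sum.cong) (auto simp: L_off inner_commute)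
    also have "\<dots> = \<alpha> *\<^sub>R c + (\<beta> * (x \<bullet> c)) *\<^sub>R x"
      using c xB finB by (auto simp: L_diag on algebra_simps)
    finally show "L c = \<alpha> *\<^sub>R c + (\<beta> * (x \<bullet> c)) *\<^sub>R x" .
  qed
  then show ?thesis
    by (simp add: L_def)
qed

subsection \<open>Projectors\<close>

lemma orthogonal_projection_unique:
  assumes V: "subspace V" and y: "y \<in> V" "\<And>v. v \<in> V \<Longrightarrow> orthogonal (x - y) v"
    and z: "z \<in> V" "\<And>v. v \<in> V \<Longrightarrow> orthogonal (x - z) v"
  shows "y = z"
proof -
  have "y - z \<in> V"
    using V y(1) z(1) by (rule subspace_diff)
  then have "(x - z) \<bullet> (y - z) - (x - y) \<bullet> (y - z) = 0"
    using y(2) z(2) by (simp add: orthogonal_def)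
  then have "(y - z) \<bullet> (y - z) = 0"
    by (simp add: inner_diff_left inner_diff_right)
  then show ?thesis
    by simp
qed

text \<open>Resolves the definite description in \<open>projector\<close>, by uniqueness of the
  orthogonal decomposition.\<close>

lemma projector_eqI:
  fixes V :: "(real ^ 'd) set"
  assumes V: "subspace V" and f: "linear f"
    and fV: "\<And>x. f x \<in> V" and orth: "\<And>x v. v \<in> V \<Longrightarrow> orthogonal (x - f x) v"
  shows "projector V = matrix f"
proof -
  have "(THE y. y \<in> V \<and> (\<forall>v\<in>V. orthogonal (x - y) v)) = f x" for x
    using orthogonal_projection_unique[OF V] fV orth by (intro the_equality) blast+
  then show ?thesis
    by (simp add: projector_def)
qed

lemma projector_orthonormal:
  fixes C :: "(real ^ 'd) set"
  assumes fin: "finite C" and on: "\<And>u w. u \<in> C \<Longrightarrow> w \<in> C \<Longrightarrow> u \<bullet> w = (if u = w then 1 else 0)"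
  shows "projector (span C) *v x = (\<Sum>c\<in>C. (x \<bullet> c) *\<^sub>R c)"
proof -
  let ?f = "\<lambda>x. \<Sum>c\<in>C. (x \<bullet> c) *\<^sub>R c"
  have f: "linear ?f"
    by (rule linearI) (simp_all add: inner_add_left scaleR_add_left sum.distrib scaleR_sum_right)
  have "projector (span C) = matrix ?f"
  proof (rule projector_eqI[OF subspace_span f])
    fix x v assume "v \<in> span C"
    then have "(\<Sum>c\<in>C. (v \<bullet> c) *\<^sub>R c) = v"
      using orthonormal_expansion[OF fin on] by blast
    moreover have "?f x \<bullet> v = x \<bullet> (\<Sum>c\<in>C. (v \<bullet> c) *\<^sub>R c)"
      by (simp add: inner_sum_left inner_sum_right mult.commute inner_commute[of v])
    ultimately show "orthogonal (x - ?f x) v"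
      by (simp add: orthogonal_def inner_diff_left)
  qed (auto intro: span_sum span_scale span_base)
  then show ?thesis
    using f by (simp add: matrix_works)
qed

text \<open>Coordinates for an arbitrary subspace; range, symmetry, fixed points and trace of the
  projector are all read off from them.\<close>

lemma projector_orthonormal_obtain:
  fixes V :: "(real ^ 'd) set"
  assumes "subspace V"
  obtains C where "finite C" "card C = dim V" "span C = V"
    "\<And>u w. u \<in> C \<Longrightarrow> w \<in> C \<Longrightarrow> u \<bullet> w = (if u = w then 1 else 0)"
    "\<And>x. projector V *v x = (\<Sum>c\<in>C. (x \<bullet> c) *\<^sub>R c)"
proof -
  obtain C where C: "pairwise orthogonal C" "\<And>x. x \<in> C \<Longrightarrow> norm x = 1"
    "independent C" "card C = dim V" "span C = V"
    using orthonormal_basis_subspace[OF assms] by metis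
  have fin: "finite C"
    using C(3) by (rule finiteI_independent)
  have on: "u \<bullet> w = (if u = w then 1 else 0)" if "u \<in> C" "w \<in> C" for u w
    using C(1,2) that by (auto simp: pairwise_def orthogonal_def dot_square_norm)
  show thesis
    using that[OF fin C(4,5) on] projector_orthonormal[OF fin on] C(5) by auto
qed

context
  fixes V :: "(real ^ 'd) set"
  assumes V: "subspace V"
begin

lemma projector_in: "projector V *v x \<in> V"
  by (rule projector_orthonormal_obtain[OF V]) (auto intro: span_sum span_scale span_base)

lemma projector_sym: "x \<bullet> (projector V *v y) = y \<bullet> (projector V *v x)"
  by (rule projector_orthonormal_obtain[OF V])
    (simp add: inner_sum_right mult.commute inner_commute)

lemma projector_fixes: "x \<in> V \<Longrightarrow> projector V *v x = x"
  by (rule projector_orthonormal_obtain[OF V]) (auto intro: orthonormal_expansion)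

lemma projector_idem: "projector V *v (projector V *v x) = projector V *v x"
  by (rule projector_fixes[OF projector_in])

lemma projector_orthogonal: "v \<in> V \<Longrightarrow> orthogonal (x - projector V *v x) v"
  unfolding orthogonal_commute[of _ v]
  using projector_sym[of x v] projector_fixes[of v]
  by (simp add: orthogonal_def inner_diff_right inner_commute[of x v])

text \<open>Turns the weight in the theorem into the quadratic form used in the moment
  computation.\<close>

lemma norm_projector_sq: "(norm (projector V *v x))\<^sup>2 = x \<bullet> (projector V *v x)"
proof -
  have "(norm (projector V *v x))\<^sup>2 = (projector V *v x) \<bullet> (projector V *v x)"
    by (rule dot_square_norm[symmetric])
  also have "\<dots> = x \<bullet> (projector V *v (projector V *v x))"
    by (rule projector_sym)
  finally show ?thesis
    by (simp only: projector_idem)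
qed

text \<open>With an orthonormal basis \<open>C\<close> of \<open>V\<close>, the trace is a double
  sum of squares; summed over \<open>Basis\<close> first, it counts the elements of
  \<open>C\<close>.\<close>

lemma trace_projector: "(\<Sum>b\<in>Basis. b \<bullet> (projector V *v b)) = real (dim V)"
proof (rule projector_orthonormal_obtain[OF V])
  fix C
  assume C: "finite C" "card C = dim V"
    "\<And>u w. u \<in> C \<Longrightarrow> w \<in> C \<Longrightarrow> u \<bullet> w = (if u = w then 1 else 0)"
    "\<And>x. projector V *v x = (\<Sum>c\<in>C. (x \<bullet> c) *\<^sub>R c)"
  have "(\<Sum>b\<in>Basis. b \<bullet> (projector V *v b)) = (\<Sum>b\<in>Basis. \<Sum>c\<in>C. (c \<bullet> b) * (c \<bullet> b))"
    unfolding C(4) inner_sum_right inner_scaleR_right by (simp only: inner_commute)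
  also have "\<dots> = (\<Sum>c\<in>C. c \<bullet> c)"
    by (subst sum.swap) (intro sum.cong refl euclidean_inner[symmetric])
  also have "\<dots> = (\<Sum>c\<in>C. 1)"
    by (intro sum.cong) (simp_all add: C(3))
  finally show ?thesis
    by (simp add: C(2))
qed

text \<open>The conjugated matrix maps into the image of \<open>V\<close>, and its residual is
  orthogonal to that image because \<open>transpose Q ** Q\<close> is the identity. The orbit map
  thereby becomes a formula continuous in \<open>Q\<close>.\<close>

lemma projector_image:
  assumes Q: "orthogonal_matrix Q"
  shows "projector ((*v) Q ` V) = Q ** projector V ** transpose Q"
proof -
  let ?f = "\<lambda>x. (Q ** projector V ** transpose Q) *v x"
  have f: "?f x = Q *v (projector V *v (transpose Q *v x))" for x
    by (simp only: matrix_vector_mul_assoc matrix_mul_assoc)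
  have "projector ((*v) Q ` V) = matrix ?f"
  proof (rule projector_eqI)
    show "subspace ((*v) Q ` V)"
      by (simp add: V linear_subspace_image)
    show "?f x \<in> (*v) Q ` V" for x
      unfolding f by (intro imageI projector_in)
    fix x v assume "v \<in> (*v) Q ` V"
    then obtain u where u: "u \<in> V" "v = Q *v u"
      by auto
    have adj: "y \<bullet> (Q *v u) = (transpose Q *v y) \<bullet> u" for y
      by (simp add: dot_lmul_matrix)
    have "transpose Q *v (x - ?f x) = transpose Q *v x - projector V *v (transpose Q *v x)"
      using Q unfolding f matrix_vector_mult_diff_distrib matrix_vector_mul_assoc[of "transpose Q" Q]
      by (simp only: orthogonal_matrix matrix_vector_mul_lid)
    then show "orthogonal (x - ?f x) v"
      using projector_orthogonal[OF u(1), of "transpose Q *v x"]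
      by (simp add: orthogonal_def u(2) adj del: transpose_matrix_vector)
  qed simp
  then show ?thesis
    by simp
qed

end

section \<open>Line projectors and the orthogonal action on the Grassmannian\<close>

lemma line_projector_mult:
  fixes x y :: "real ^ 'd"
  assumes "norm x = 1"
  shows "line_projector x *v y = (x \<bullet> y) *\<^sub>R x"
  using projector_orthonormal[of "{x}" y] assms by (simp add: norm_eq_1 inner_commute)

text \<open>The matrix is the outer product of \<open>x\<close> with itself, so the generators of
  \<open>grassmannian_Pol\<close> become products of quadratic forms.\<close>

lemma trace_inner_line_projector:
  fixes x :: "real ^ 'd"
  assumes "norm x = 1"
  shows "trace_inner (line_projector x) A = x \<bullet> (A *v x)"
proof -
  have "line_projector x = (\<chi> i j. x $ i * x $ j)"
    by (simp add: matrix_eq line_projector_mult[OF assms])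
      (simp add: vec_eq_iff matrix_vector_mult_def inner_vec_def sum_distrib_left mult_ac)
  then show ?thesis
    by (simp add: trace_inner_def trace_def matrix_matrix_mult_def inner_vec_def matrix_vector_mult_def
        sum_distrib_left mult.assoc)
      (subst sum.swap, simp add: mult_ac)
qed

lemma inner_conjugate:
  fixes P Q :: "real ^ 'd ^ 'd"
  shows "x \<bullet> ((Q ** P ** transpose Q) *v x) = (transpose Q *v x) \<bullet> (P *v (transpose Q *v x))"
proof -
  have "(Q ** P ** transpose Q) *v x = Q *v (P *v (transpose Q *v x))"
    by (simp only: matrix_vector_mul_assoc matrix_mul_assoc)
  then show ?thesis
    by (simp add: dot_lmul_matrix)
qed

text \<open>Ensures that the choice of base point in \<open>grassmannian_measure\<close> yields a
  genuine \<open>k\<close>-dimensional subspace.\<close>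

lemma grassmannian_nonempty:
  assumes "k \<le> CARD('d)"
  obtains W :: "(real ^ 'd) set" where "W \<in> grassmannian k"
  using assms choose_subspace_of_subspace[of k "UNIV :: (real ^ 'd) set"]
  by (auto simp: grassmannian_def)

lemma orthogonal_image_grassmannian:
  assumes "W \<in> grassmannian k" and "orthogonal_matrix Q"
  shows "(*v) Q ` W \<in> grassmannian k"
proof -
  have "inj ((*v) Q)"
    using assms(2) by (metis inj_matrix_vector_mult invertible_def orthogonal_matrix_def)
  then have "dim ((*v) Q ` W) = dim W"
    by (intro dim_image_eq) (auto simp: inj_on_def)
  then show ?thesis
    using assms(1) by (auto simp: grassmannian_def linear_subspace_image)
qed

subsection \<open>Invariance of cubatures\<close>

text \<open>The \<open>\<sigma>\<close>-algebra on the Grassmannian is pulled back along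
  \<open>projector\<close>, so it suffices that \<open>Q ** projector W ** transpose Q\<close> is
  continuous in \<open>Q\<close>.\<close>

lemma measurable_orbit:
  fixes W :: "(real ^ 'd) set"
  assumes W: "W \<in> grassmannian k"
    and H: "sets H = sets (restrict_space borel orthogonal_group)"
  shows "(\<lambda>Q. (*v) Q ` W) \<in> H \<rightarrow>\<^sub>M grassmannian_borel k"
  unfolding grassmannian_borel_def
proof (rule measurable_vimage_algebra2)
  have spH: "space H = (orthogonal_group :: (real ^ 'd ^ 'd) set)"
    using sets_eq_imp_space_eq[OF H] by (simp add: space_restrict_space)
  show "(\<lambda>Q. (*v) Q ` W) \<in> space H \<rightarrow> grassmannian k"
    using orthogonal_image_grassmannian[OF W] by (auto simp: spH orthogonal_group_def)
  have sW: "subspace W"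
    using W by (simp add: grassmannian_def)
  have "continuous_on orthogonal_group (\<lambda>Q. Q ** projector W ** transpose Q)"
    unfolding matrix_matrix_mult_def transpose_def by (intro continuous_intros)
  then have "(\<lambda>Q. Q ** projector W ** transpose Q) \<in> borel_measurable (restrict_space borel orthogonal_group)"
    by (rule borel_measurable_continuous_on_restrict)
  then have "(\<lambda>Q. Q ** projector W ** transpose Q) \<in> borel_measurable H"
    using measurable_cong_sets[OF H refl] by blast
  \<comment> \<open>The conjugation formula holds for orthogonal \<open>Q\<close> only, hence the
    congruence on \<open>space H\<close>.\<close>
  then show "(\<lambda>Q. projector ((*v) Q ` W)) \<in> borel_measurable H"
    by (rule iffD1[OF measurable_cong, rotated])
      (simp add: spH orthogonal_group_def projector_image[OF sW])
qed

lemma measurable_left_mult: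
  fixes S :: "real ^ 'd ^ 'd"
  assumes S: "orthogonal_matrix S"
    and H: "sets H = sets (restrict_space borel orthogonal_group)"
  shows "(\<lambda>R. S ** R) \<in> H \<rightarrow>\<^sub>M H"
proof -
  have "continuous_on orthogonal_group (\<lambda>R. S ** R)"
    unfolding matrix_matrix_mult_def by (intro continuous_intros)
  then have "(\<lambda>R. S ** R) \<in> borel_measurable (restrict_space borel orthogonal_group)"
    by (rule borel_measurable_continuous_on_restrict)
  then have "(\<lambda>R. S ** R) \<in> restrict_space borel orthogonal_group \<rightarrow>\<^sub>M restrict_space borel orthogonal_group"
    using S by (intro measurable_restrict_space2) (auto simp: space_restrict_space orthogonal_group_def orthogonal_matrix_mul)
  then show ?thesis
    using measurable_cong_sets[OF H H] by blast
qed

text \<open>Cubature rewrites \<open>e\<close> as an integral over Haar measure, where replacing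
  \<open>R\<close> by \<open>S ** R\<close> absorbs \<open>S\<close>. Unit vectors are required
  because the generators of \<open>grassmannian_Pol\<close> use points of the sphere.\<close>

lemma cubature_invariant_unit:
  fixes H :: "(real ^ 'd ^ 'd) measure" and u v :: "real ^ 'd" and k n :: nat
    and V :: "nat \<Rightarrow> (real ^ 'd) set" and \<omega> :: "nat \<Rightarrow> real"
  defines "e \<equiv> \<lambda>u v. \<Sum>j=1..n. \<omega> j * ((u \<bullet> (projector (V j) *v u)) * (v \<bullet> (projector (V j) *v v)))"
  assumes k: "k \<le> CARD('d)"
    and haar: "haar_probability H" and cub: "grassmannian_cubature H k 2 n V \<omega>"
    and S: "orthogonal_matrix S" and u: "norm u = 1" and v: "norm v = 1"
  shows "e (S *v u) (S *v v) = e u v"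
proof -
  define W :: "(real ^ 'd) set" where "W = (SOME V. V \<in> grassmannian k)"
  have W: "W \<in> grassmannian k"
    unfolding W_def using grassmannian_nonempty[OF k] by (metis someI_ex)
  then have sW: "subspace W"
    by (simp add: grassmannian_def)
  have setsH: "sets H = sets (restrict_space borel orthogonal_group)"
    using haar by (simp add: haar_probability_def)
  have spH: "space H = orthogonal_group"
    using sets_eq_imp_space_eq[OF setsH] by (simp add: space_restrict_space)
  let ?q = "\<lambda>R a. a \<bullet> (projector ((*v) R ` W) *v a)"
  have proj_meas: "projector \<in> borel_measurable (grassmannian_borel k)"
    unfolding grassmannian_borel_def by (rule measurable_vimage_algebra1) simp
  have e_int: "e a b = (LINT R|H. ?q R a * ?q R b)" if a: "norm a = 1" and b: "norm b = 1" for a b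
  proof -
    let ?f = "\<lambda>U. (a \<bullet> (projector U *v a)) * (b \<bullet> (projector U *v b))"
    \<comment> \<open>The integrand is a single generator: one summand with coefficient 1 and the
      two sphere points \<open>a\<close> and \<open>b\<close>.\<close>
    let ?X = "\<lambda>(i::nat) (l::nat). if l = 0 then a else b"
    have "?f U = (\<Sum>i<(1::nat). 1 * (\<Prod>l<2. trace_inner (line_projector (?X i l)) (projector U)))" for U
      by (simp add: numeral_2_eq_2 trace_inner_line_projector a b)
    then have "?f \<in> grassmannian_Pol k 2"
      unfolding grassmannian_Pol_def mem_Collect_eq
      by (intro exI[of _ "1::nat"] exI[of _ "\<lambda>_. 1"] exI[of _ ?X]) (auto simp: a b)
    then have "e a b = (LINT U|grassmannian_measure H k. ?f U)"
      using cub by (simp add: grassmannian_cubature_def e_def)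
    also have "\<dots> = (LINT R|H. ?f ((*v) R ` W))"
      unfolding grassmannian_measure_def W_def[symmetric]
    proof (rule integral_distr[OF measurable_orbit[OF W setsH]])
      have "continuous_on UNIV (\<lambda>P::real^'d^'d. (a \<bullet> (P *v a)) * (b \<bullet> (P *v b)))"
        unfolding matrix_vector_mult_def by (intro continuous_intros)
      then show "?f \<in> borel_measurable (grassmannian_borel k)"
        using measurable_compose[OF proj_meas borel_measurable_continuous_onI] by simp
    qed
    finally show ?thesis .
  qed
  \<comment> \<open>Moving the subspace and the vector by the same \<open>S\<close> changes nothing:
    \<open>transpose (S ** R)\<close> applied to \<open>S *v a\<close> is
    \<open>transpose R *v a\<close>.\<close>
  have orb: "?q (S ** R) (S *v a) = ?q R a" if R: "R \<in> space H" for R a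
  proof -
    have R: "orthogonal_matrix R"
      using R by (simp add: spH orthogonal_group_def)
    have "transpose (S ** R) *v (S *v a) = transpose R *v a"
      using S by (simp only: orthogonal_matrix_def matrix_transpose_mul matrix_vector_mul_assoc
          matrix_mul_assoc[symmetric] matrix_mul_rid)
    then show ?thesis
      using R S by (simp add: projector_image[OF sW] orthogonal_matrix_mul inner_conjugate
          del: transpose_matrix_vector)
  qed
  have nS: "norm (S *v a) = norm a" for a
    using S orthogonal_transformation_matrix[of "(*v) S"] orthogonal_transformation_norm by auto
  let ?g = "\<lambda>R. ?q R (S *v u) * ?q R (S *v v)"
  have g: "?g \<in> borel_measurable H"
  proof -
    have "continuous_on UNIV (\<lambda>P::real^'d^'d. ((S *v u) \<bullet> (P *v (S *v u))) * ((S *v v) \<bullet> (P *v (S *v v))))"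
      unfolding matrix_vector_mult_def by (intro continuous_intros)
    then show ?thesis
      using measurable_compose[OF measurable_compose[OF measurable_orbit[OF W setsH] proj_meas] borel_measurable_continuous_onI]
      by simp
  qed
  have "e (S *v u) (S *v v) = (LINT R|H. ?g R)"
    by (rule e_int) (simp_all add: nS u v)
  also have "\<dots> = (LINT R|distr H H (\<lambda>R. S ** R). ?g R)"
    using haar S by (simp add: haar_probability_def orthogonal_group_def)
  also have "\<dots> = (LINT R|H. ?g (S ** R))"
    by (rule integral_distr[OF measurable_left_mult[OF S setsH] g])
  also have "\<dots> = (LINT R|H. ?q R u * ?q R v)"
    by (intro Bochner_Integration.integral_cong) (simp_all add: orb)
  also have "\<dots> = e u v"
    by (rule e_int[OF u v, symmetric])
  finally show ?thesis .
qed

text \<open>Homogeneity of degree 2 in each argument removes the normalisation, as the polarisation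
  needs vectors such as \<open>x + b\<close>. Zero vectors cannot be normalised and are treated
  apart.\<close>

lemma cubature_invariant:
  fixes H :: "(real ^ 'd ^ 'd) measure" and u v :: "real ^ 'd" and k n :: nat
    and V :: "nat \<Rightarrow> (real ^ 'd) set" and \<omega> :: "nat \<Rightarrow> real"
  defines "e \<equiv> \<lambda>u v. \<Sum>j=1..n. \<omega> j * ((u \<bullet> (projector (V j) *v u)) * (v \<bullet> (projector (V j) *v v)))"
  assumes k: "k \<le> CARD('d)"
    and haar: "haar_probability H" and cub: "grassmannian_cubature H k 2 n V \<omega>"
    and f: "orthogonal_transformation f"
  shows "e (f u) (f v) = e u v"
proof (cases "u = 0 \<or> v = 0")
  case True
  then show ?thesis
    using linear_0[OF orthogonal_transformation_linear[OF f]] by (auto simp: e_def)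
next
  case False
  have S: "orthogonal_matrix (matrix f)" and f_eq: "matrix f *v y = f y" for y
    using f by (auto simp: orthogonal_transformation_matrix matrix_works)
  have scale: "e (r *\<^sub>R a) (s *\<^sub>R b) = (r\<^sup>2 * s\<^sup>2) * e a b" for r s a b
    unfolding e_def sum_distrib_left
    by (intro sum.cong) (auto simp: linear_cmul[OF matrix_vector_mul_linear] power2_eq_square)
  define u' v' where "u' = u /\<^sub>R norm u" and "v' = v /\<^sub>R norm v"
  have n: "norm u' = 1" "norm v' = 1" and uv: "u = norm u *\<^sub>R u'" "v = norm v *\<^sub>R v'"
    using False by (auto simp: u'_def v'_def)
  have "e (f u') (f v') = e u' v'"
    using cubature_invariant_unit[OF k haar cub S n] by (simp add: e_def f_eq)
  moreover have "f u = norm u *\<^sub>R f u'" "f v = norm v *\<^sub>R f v'"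
    using uv orthogonal_transformation_scaleR[OF f] by metis+
  ultimately show ?thesis
    using uv scale by metis
qed

section \<open>Solving the moment identity for the line projector\<close>

theorem proposition3p1:
  fixes H :: "(real ^ 'd ^ 'd) measure"
    and k d n :: nat
    and V :: "nat \<Rightarrow> (real ^ 'd) set"
    and \<omega> :: "nat \<Rightarrow> real"
    and x :: "real ^ 'd"
    and a1 a2 :: real
  assumes "CARD('d) = d"
    and "1 \<le> k" and "k < d"
    and "haar_probability H"
    and "grassmannian_cubature H k 2 n V \<omega>"
    and "x \<in> sphere 0 1"
    and "a1 = real d * (real d + 2) * (real d - 1) / (2 * real k * (real d - real k))"
    and "a2 = (real k * real d + real k - 2) / (2 * (real d - real k))"
  shows "line_projector x =
           a1 *\<^sub>R (\<Sum>j=1..n. (\<omega> j * (norm (projector (V j) *v x))\<^sup>2) *\<^sub>R projector (V j))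
           - a2 *\<^sub>R mat 1"
proof -
  define D K where "D = real d" and "K = real k"
  have DK: "D \<ge> 2" "K \<ge> 1" "K < D"
    using assms(2,3) by (auto simp: D_def K_def)
  define \<beta> where "\<beta> = 2 * K * (D - K) / (D * (D + 2) * (D - 1))"
  define \<alpha> where "\<alpha> = K / D - (D + 1) * \<beta> / 2"
  have nx: "norm x = 1"
    using assms(6) by simp
  have V: "subspace (V j)" "dim (V j) = k" if "j \<in> {1..n}" for j
    using assms(5) that by (auto simp: grassmannian_cubature_def grassmannian_def)
  have M: "(\<Sum>j=1..n. (\<omega> j * (x \<bullet> (projector (V j) *v x))) *\<^sub>R (projector (V j) *v y))
      = \<alpha> *\<^sub>R y + (\<beta> * (x \<bullet> y)) *\<^sub>R x" for y
  proof (rule invariant_projections_moment[where d = D and \<kappa> = K])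
    show "(\<Sum>j=1..n. \<omega> j) = 1"
      using assms(5) by (simp add: grassmannian_cubature_def)
    show "(\<Sum>j=1..n. \<omega> j * (f u \<bullet> (projector (V j) *v f u) * (f v \<bullet> (projector (V j) *v f v))))
        = (\<Sum>j=1..n. \<omega> j * (u \<bullet> (projector (V j) *v u) * (v \<bullet> (projector (V j) *v v))))"
      if "orthogonal_transformation f" for f u v
      by (rule cubature_invariant[OF _ assms(4,5) that]) (use assms(1,3) in simp)
    show "u \<bullet> (projector (V j) *v v) = v \<bullet> (projector (V j) *v u)" if "j \<in> {1..n}" for j u v
      by (rule projector_sym[OF V(1)[OF that]])
    show "2 \<le> DIM(real ^ 'd)" "D = real DIM(real ^ 'd)"
      using assms(1,2,3) by (simp_all add: D_def)
    show "(\<Sum>b\<in>Basis. b \<bullet> (projector (V j) *v b)) = K" if "j \<in> {1..n}" for j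
      using trace_projector[OF V(1)[OF that]] V(2)[OF that] by (simp only: K_def)
  qed (use DK in \<open>simp_all add: \<alpha>_def \<beta>_def projector_idem V nx\<close>)
  \<comment> \<open>The constants of the theorem are \<open>1 / \<beta>\<close> and
    \<open>\<alpha> / \<beta>\<close>: multiplying the identity \<open>M\<close> by
    \<open>a1\<close> and subtracting \<open>a2 *\<^sub>R y\<close> isolates
    \<open>(x \<bullet> y) *\<^sub>R x\<close>.\<close>
  have a1\<beta>: "a1 * \<beta> = 1"
    using DK by (simp add: assms(7) \<beta>_def flip: D_def K_def)
  have "a1 * \<alpha> = a1 * K / D - (D + 1) * (a1 * \<beta>) / 2"
    by (simp add: \<alpha>_def algebra_simps)
  also have "a1 * K / D = (D + 2) * (D - 1) / (2 * (D - K))"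
    using DK by (simp add: assms(7) flip: D_def K_def)
  also have "\<dots> - (D + 1) * (a1 * \<beta>) / 2 = a2"
    unfolding a1\<beta> assms(8) D_def[symmetric] K_def[symmetric] using DK by (simp add: field_simps)
  finally have a1\<alpha>: "a1 * \<alpha> = a2" .
  \<comment> \<open>The matrix equation is tested on vectors; linearity in the matrix carries
    evaluation at \<open>y\<close> through the sum.\<close>
  have lin: "linear (\<lambda>A :: real ^ 'd ^ 'd. A *v y)" for y
    by (rule linearI) (simp_all add: matrix_vector_mult_add_rdistrib scaleR_matrix_vector_assoc)
  show ?thesis
    unfolding matrix_eq
  proof
    fix y :: "real ^ 'd"
    have "(\<Sum>j=1..n. (\<omega> j * (norm (projector (V j) *v x))\<^sup>2) *\<^sub>R projector (V j)) *v y
        = (\<Sum>j=1..n. (\<omega> j * (x \<bullet> (projector (V j) *v x))) *\<^sub>R (projector (V j) *v y))"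
      unfolding linear_sum[OF lin]
      by (intro sum.cong) (simp_all add: linear_cmul[OF lin] norm_projector_sq V)
    also note M
    finally have "(a1 *\<^sub>R (\<Sum>j=1..n. (\<omega> j * (norm (projector (V j) *v x))\<^sup>2) *\<^sub>R projector (V j))
          - a2 *\<^sub>R mat 1) *v y = a1 *\<^sub>R (\<alpha> *\<^sub>R y + (\<beta> * (x \<bullet> y)) *\<^sub>R x) - a2 *\<^sub>R y"
      by (simp add: linear_diff[OF lin] linear_cmul[OF lin])
    also have "\<dots> = (a1 * \<beta> * (x \<bullet> y)) *\<^sub>R x"
      by (simp add: scaleR_add_right a1\<alpha> mult.assoc)
    finally show "line_projector x *v y = (a1 *\<^sub>R (\<Sum>j=1..n. (\<omega> j * (norm (projector (V j) *v x))\<^sup>2)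
        *\<^sub>R projector (V j)) - a2 *\<^sub>R mat 1) *v y"
      by (simp add: a1\<beta> line_projector_mult[OF nx])
  qed
qed

end
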